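(* Let $n\ge 1$. Then (i) $\mathcal{IC}_n$ is abundant; (ii) $\mathcal{Q}'_n$ is right abundant.
   Context: Let $[n]=\{1,2,\ldots,n\}$ with its usual order. $\mathcal{IC}_n$ is the monoid of all injective partial transformations $\alpha$ of $[n]$ (the empty map allowed) that are isotone ($x\le y$ implies $x\alpha\le y\alpha$ for all $x,y\in\mathrm{Dom}\,\alpha$) and order-decreasing ($x\alpha\le x$ for all $x\in \mathrm{Dom}\,\alpha$), maps being written on the right and composed left to right: $x(\alpha\beta)=(x\alpha)\beta$. $\mathcal{Q}'_n=\{\alpha\in\mathcal{IC}_n: 1\notin\mathrm{Dom}\,\alpha\}$ is a subsemigroup. For a semigroup $S$ and $a,b\in S$: $a\,\mathcal{L}^*\,b$ iff for all $x,y\in S^1$, $ax=ay\Leftrightarrow bx=by$; $a\,\mathcal{R}^*\,b$ iff for all $x,y\in S^1$, $xa=ya\Leftrightarrow xb=yb$. $S$ is left abundant if every $\mathcal{L}^*$-class contains an idempotent, right abundant if every $\mathcal{R}^*$-class contains an idempotent, and abundant if it is both. *)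

theory Defs imports Main begin

text \<open>A semigroup is given by a carrier set \<open>S\<close> and a multiplication \<open>m\<close> on the ambient type.\<close>

definition semigroup_on :: "'a set \<Rightarrow> ('a \<Rightarrow> 'a \<Rightarrow> 'a) \<Rightarrow> bool" where
  "semigroup_on S m \<longleftrightarrow>
     (\<forall>x\<in>S. \<forall>y\<in>S. m x y \<in> S) \<and>
     (\<forall>x\<in>S. \<forall>y\<in>S. \<forall>z\<in>S. m (m x y) z = m x (m y z))"

definition is_identity_on :: "'a set \<Rightarrow> ('a \<Rightarrow> 'a \<Rightarrow> 'a) \<Rightarrow> 'a \<Rightarrow> bool" where
  "is_identity_on S m e \<longleftrightarrow> e \<in> S \<and> (\<forall>x\<in>S. m e x = x \<and> m x e = x)"

text \<open>\<open>S\<^sup>1\<close> is \<open>S\<close> if \<open>S\<close> has an identity, and otherwise \<open>S\<close> with an identity adjoined.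
  Elements of \<open>S\<close> are embedded by \<^const>\<open>Some\<close>; the adjoined identity is \<^const>\<open>None\<close>.\<close>

definition adjoin_one :: "'a set \<Rightarrow> ('a \<Rightarrow> 'a \<Rightarrow> 'a) \<Rightarrow> 'a option set" where
  "adjoin_one S m =
     (if \<exists>e. is_identity_on S m e then Some ` S else insert None (Some ` S))"

fun mult_one :: "('a \<Rightarrow> 'a \<Rightarrow> 'a) \<Rightarrow> 'a option \<Rightarrow> 'a option \<Rightarrow> 'a option" where
  "mult_one m None y = y"
| "mult_one m (Some x) None = Some x"
| "mult_one m (Some x) (Some y) = Some (m x y)"

definition Lstar :: "'a set \<Rightarrow> ('a \<Rightarrow> 'a \<Rightarrow> 'a) \<Rightarrow> ('a \<times> 'a) set" where
  "Lstar S m = {(a, b). a \<in> S \<and> b \<in> S \<and>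
     (\<forall>x\<in>adjoin_one S m. \<forall>y\<in>adjoin_one S m.
        mult_one m (Some a) x = mult_one m (Some a) y \<longleftrightarrow>
        mult_one m (Some b) x = mult_one m (Some b) y)}"

definition Rstar :: "'a set \<Rightarrow> ('a \<Rightarrow> 'a \<Rightarrow> 'a) \<Rightarrow> ('a \<times> 'a) set" where
  "Rstar S m = {(a, b). a \<in> S \<and> b \<in> S \<and>
     (\<forall>x\<in>adjoin_one S m. \<forall>y\<in>adjoin_one S m.
        mult_one m x (Some a) = mult_one m y (Some a) \<longleftrightarrow>
        mult_one m x (Some b) = mult_one m y (Some b))}"

lemma equiv_Lstar: "equiv S (Lstar S m)"
  by (auto simp: equiv_def refl_on_def sym_def trans_def Lstar_def)

lemma equiv_Rstar: "equiv S (Rstar S m)"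
  by (auto simp: equiv_def refl_on_def sym_def trans_def Rstar_def)

definition left_abundant :: "'a set \<Rightarrow> ('a \<Rightarrow> 'a \<Rightarrow> 'a) \<Rightarrow> bool" where
  "left_abundant S m \<longleftrightarrow> (\<forall>C \<in> S // Lstar S m. \<exists>e\<in>C. m e e = e)"

definition right_abundant :: "'a set \<Rightarrow> ('a \<Rightarrow> 'a \<Rightarrow> 'a) \<Rightarrow> bool" where
  "right_abundant S m \<longleftrightarrow> (\<forall>C \<in> S // Rstar S m. \<exists>e\<in>C. m e e = e)"

definition abundant :: "'a set \<Rightarrow> ('a \<Rightarrow> 'a \<Rightarrow> 'a) \<Rightarrow> bool" where
  "abundant S m \<longleftrightarrow> left_abundant S m \<and> right_abundant S m"

text \<open>Partial transformations of \<open>{1..n}\<close> are partial maps on \<^typ>\<open>nat\<close> with domain and range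
  in \<open>{1..n}\<close>. They act on the right, so the product \<open>\<alpha>\<beta>\<close> applies \<open>\<alpha>\<close> first.\<close>

definition pt_mult :: "(nat \<rightharpoonup> nat) \<Rightarrow> (nat \<rightharpoonup> nat) \<Rightarrow> (nat \<rightharpoonup> nat)" where
  "pt_mult \<alpha> \<beta> = \<beta> \<circ>\<^sub>m \<alpha>"

definition IC :: "nat \<Rightarrow> (nat \<rightharpoonup> nat) set" where
  "IC n = {\<alpha>. dom \<alpha> \<subseteq> {1..n} \<and> ran \<alpha> \<subseteq> {1..n} \<and> inj_on \<alpha> (dom \<alpha>) \<and>
     (\<forall>x\<in>dom \<alpha>. \<forall>y\<in>dom \<alpha>. x \<le> y \<longrightarrow> the (\<alpha> x) \<le> the (\<alpha> y)) \<and>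
     (\<forall>x\<in>dom \<alpha>. the (\<alpha> x) \<le> x)}"

definition Q' :: "nat \<Rightarrow> (nat \<rightharpoonup> nat) set" where
  "Q' n = {\<alpha> \<in> IC n. 1 \<notin> dom \<alpha>}"

lemma pt_mult_assoc: "pt_mult (pt_mult \<alpha> \<beta>) \<gamma> = pt_mult \<alpha> (pt_mult \<beta> \<gamma>)"
  by (auto simp: pt_mult_def map_comp_def fun_eq_iff split: option.splits)

lemma dom_pt_mult: "x \<in> dom (pt_mult \<alpha> \<beta>) \<longleftrightarrow> x \<in> dom \<alpha> \<and> the (\<alpha> x) \<in> dom \<beta>"
  by (auto simp: pt_mult_def map_comp_def dom_def split: option.splits)

lemma the_pt_mult:
  assumes "x \<in> dom (pt_mult \<alpha> \<beta>)"
  shows "the (pt_mult \<alpha> \<beta> x) = the (\<beta> (the (\<alpha> x)))"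
  using assms by (auto simp: pt_mult_def map_comp_def dom_def split: option.splits)

lemma ran_pt_mult: "ran (pt_mult \<alpha> \<beta>) \<subseteq> ran \<beta>"
  by (auto simp: pt_mult_def map_comp_def ran_def split: option.splits)

lemma IC_D:
  assumes "\<alpha> \<in> IC n"
  shows "x \<in> dom \<alpha> \<Longrightarrow> x \<in> {1..n}" "y \<in> ran \<alpha> \<Longrightarrow> y \<in> {1..n}"
    "x \<in> dom \<alpha> \<Longrightarrow> y \<in> dom \<alpha> \<Longrightarrow> \<alpha> x = \<alpha> y \<Longrightarrow> x = y"
    "x \<in> dom \<alpha> \<Longrightarrow> y \<in> dom \<alpha> \<Longrightarrow> x \<le> y \<Longrightarrow> the (\<alpha> x) \<le> the (\<alpha> y)"
    "x \<in> dom \<alpha> \<Longrightarrow> the (\<alpha> x) \<le> x"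
  using assms unfolding IC_def inj_on_def by blast+

lemma IC_inj:
  assumes "\<alpha> \<in> IC n" "x \<in> dom \<alpha>" "y \<in> dom \<alpha>" "the (\<alpha> x) = the (\<alpha> y)"
  shows "x = y"
  using IC_D(3)[OF assms(1-3)] assms(2-4) by auto

lemma pt_mult_IC:
  assumes \<alpha>: "\<alpha> \<in> IC n" and \<beta>: "\<beta> \<in> IC n"
  shows "pt_mult \<alpha> \<beta> \<in> IC n"
proof -
  let ?\<gamma> = "pt_mult \<alpha> \<beta>"
  have d: "x \<in> dom \<alpha>" "the (\<alpha> x) \<in> dom \<beta>" "the (?\<gamma> x) = the (\<beta> (the (\<alpha> x)))"
    if "x \<in> dom ?\<gamma>" for x
    using that dom_pt_mult the_pt_mult by metis+
  have "dom ?\<gamma> \<subseteq> {1..n}"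
    using d(1) IC_D(1)[OF \<alpha>] by (meson subsetI)
  moreover have "ran ?\<gamma> \<subseteq> {1..n}"
    using ran_pt_mult[of \<alpha> \<beta>] IC_D(2)[OF \<beta>] by (meson subsetI subsetD)
  moreover have "inj_on ?\<gamma> (dom ?\<gamma>)"
  proof (rule inj_onI)
    fix x y assume x: "x \<in> dom ?\<gamma>" and y: "y \<in> dom ?\<gamma>" and eq: "?\<gamma> x = ?\<gamma> y"
    have "the (\<beta> (the (\<alpha> x))) = the (\<beta> (the (\<alpha> y)))"
      using d(3)[OF x] d(3)[OF y] eq by metis
    from IC_inj[OF \<beta> d(2)[OF x] d(2)[OF y] this] show "x = y"
      by (rule IC_inj[OF \<alpha> d(1)[OF x] d(1)[OF y]])
  qed
  moreover have "the (?\<gamma> x) \<le> the (?\<gamma> y)" if "x \<in> dom ?\<gamma>" "y \<in> dom ?\<gamma>" "x \<le> y" for x y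
    using IC_D(4)[OF \<beta> d(2)[OF that(1)] d(2)[OF that(2)]
        IC_D(4)[OF \<alpha> d(1)[OF that(1)] d(1)[OF that(2)] that(3)]]
    by (simp only: d(3)[OF that(1)] d(3)[OF that(2)])
  moreover have "the (?\<gamma> x) \<le> x" if "x \<in> dom ?\<gamma>" for x
    using order_trans[OF IC_D(5)[OF \<beta> d(2)[OF that]] IC_D(5)[OF \<alpha> d(1)[OF that]]]
    by (simp only: d(3)[OF that])
  ultimately show ?thesis by (simp only: IC_def mem_Collect_eq) simp
qed

lemma semigroup_IC: "semigroup_on (IC n) pt_mult"
  by (simp add: semigroup_on_def pt_mult_assoc pt_mult_IC)

lemma identity_IC: "is_identity_on (IC n) pt_mult (Some |` {1..n})"
proof -
  have "pt_mult (Some |` {1..n}) \<alpha> = \<alpha> \<and> pt_mult \<alpha> (Some |` {1..n}) = \<alpha>"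
    if "\<alpha> \<in> IC n" for \<alpha>
  proof -
    have "x \<in> {1..n} \<and> y \<in> {1..n}" if "\<alpha> x = Some y" for x y
      using IC_D(1,2)[OF \<open>\<alpha> \<in> IC n\<close>] domI[of \<alpha> x y] ranI[of \<alpha> x y] that by metis
    then have "pt_mult (Some |` {1..n}) \<alpha> x = \<alpha> x" "pt_mult \<alpha> (Some |` {1..n}) x = \<alpha> x" for x
      by (cases "\<alpha> x"; force simp: pt_mult_def map_comp_def restrict_map_def)+
    then show ?thesis by blast
  qed
  moreover have "Some |` {1..n} \<in> IC n"
    by (auto simp: IC_def inj_on_def restrict_map_def ran_def split: if_splits)
  ultimately show ?thesis by (simp add: is_identity_on_def)
qed

lemma semigroup_Q': "semigroup_on (Q' n) pt_mult"
  by (auto simp: semigroup_on_def pt_mult_assoc pt_mult_IC Q'_def dom_pt_mult simp del: domIff)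

end

(* The partial identity on Ran \<alpha> is an idempotent L*-related to \<alpha>, and, as \<alpha> is injective,
   the partial identity on Dom \<alpha> is an idempotent R*-related to \<alpha>. Partial identities
   belong to IC n, and the one on Dom \<alpha> misses 1 if \<alpha> does; the one on Ran \<alpha> need not,
   which is why Q' n is only claimed to be right abundant. *)

theory Submission imports Defs begin

lemma left_abundantI:
  assumes "\<And>a. a \<in> S \<Longrightarrow> \<exists>e. (a, e) \<in> Lstar S m \<and> m e e = e"
  shows "left_abundant S m"
  using assms by (fastforce simp: left_abundant_def quotient_def)

lemma right_abundantI:
  assumes "\<And>a. a \<in> S \<Longrightarrow> \<exists>e. (a, e) \<in> Rstar S m \<and> m e e = e"
  shows "right_abundant S m"
  using assms by (fastforce simp: right_abundant_def quotient_def)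

(* Some, the identity map on all natural numbers, stands in for the adjoined identity. *)
lemma mult_one_pt_mult_right:
  "mult_one pt_mult (Some \<alpha>) u = Some (pt_mult \<alpha> (case_option Some id u))"
  by (cases u) (auto simp: pt_mult_def map_comp_def fun_eq_iff split: option.splits)

lemma mult_one_pt_mult_left:
  "mult_one pt_mult u (Some \<alpha>) = Some (pt_mult (case_option Some id u) \<alpha>)"
  by (cases u) (auto simp: pt_mult_def map_comp_def fun_eq_iff split: option.splits)

lemma partial_id_idem: "pt_mult (Some |` A) (Some |` A) = Some |` A"
  by (auto simp: pt_mult_def map_comp_def restrict_map_def fun_eq_iff)

lemma partial_id_IC: "A \<subseteq> {1..n} \<Longrightarrow> Some |` A \<in> IC n"
  by (auto simp: IC_def inj_on_def restrict_map_def ran_def split: if_splits)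

text \<open>Only the values on \<open>ran \<alpha>\<close> matter: each equation says that
  \<open>\<beta>\<close> and \<open>\<gamma>\<close> agree there, being undefined at the same points
  included.\<close>

lemma pt_mult_cancel_ran:
  "pt_mult \<alpha> \<beta> = pt_mult \<alpha> \<gamma> \<longleftrightarrow> pt_mult (Some |` ran \<alpha>) \<beta> = pt_mult (Some |` ran \<alpha>) \<gamma>"
proof -
  \<comment> \<open>Here \<open>\<alpha>\<close> is generalized, so that the criterion also applies
    to the partial identity, which has the same range.\<close>
  have "pt_mult \<alpha> \<beta> = pt_mult \<alpha> \<gamma> \<longleftrightarrow> (\<forall>y \<in> ran \<alpha>. \<beta> y = \<gamma> y)" for \<alpha>
    by (fastforce simp: pt_mult_def map_comp_def fun_eq_iff ran_def split: option.splits)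
  moreover have "ran (Some |` ran \<alpha>) = ran \<alpha>"
    by (auto simp: ran_def restrict_map_def)
  ultimately show ?thesis by metis
qed

text \<open>At each point, both equations say that \<open>\<beta>\<close> and
  \<open>\<gamma>\<close> have the same value or that neither has a value in
  \<open>dom \<alpha>\<close>.\<close>

lemma pt_mult_cancel_dom:
  assumes "inj_on \<alpha> (dom \<alpha>)"
  shows "pt_mult \<beta> \<alpha> = pt_mult \<gamma> \<alpha> \<longleftrightarrow> pt_mult \<beta> (Some |` dom \<alpha>) = pt_mult \<gamma> (Some |` dom \<alpha>)"
proof -
  have eq: "pt_mult \<beta> \<alpha> x = pt_mult \<gamma> \<alpha> x \<longleftrightarrow>
      pt_mult \<beta> (Some |` dom \<alpha>) x = pt_mult \<gamma> (Some |` dom \<alpha>) x" for x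
  \<comment> \<open>Injectivity enters only when both values are defined. If just one is, both sides
    say that it lies outside \<open>dom \<alpha>\<close>.\<close>
  proof (cases "\<beta> x"; cases "\<gamma> x")
    fix y z assume "\<beta> x = Some y" "\<gamma> x = Some z"
    then show ?thesis
      using inj_onD[OF assms, of y z]
      by (auto simp: pt_mult_def map_comp_def restrict_map_def domIff)
  qed (auto simp: pt_mult_def map_comp_def restrict_map_def eq_commute[of None])
  then show ?thesis by (simp add: fun_eq_iff)
qed

text \<open>The cancellation lemma holds for arbitrary partial maps, hence for any \<open>S\<close>
  and also for \<open>Some\<close> in the role of an adjoined identity.\<close>

lemma Lstar_partial_id_ran:
  assumes "\<alpha> \<in> S" "Some |` ran \<alpha> \<in> S"
  shows "(\<alpha>, Some |` ran \<alpha>) \<in> Lstar S pt_mult"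
  using assms pt_mult_cancel_ran[of \<alpha>] by (simp add: Lstar_def mult_one_pt_mult_right)

lemma Rstar_partial_id_dom:
  assumes "\<alpha> \<in> S" "Some |` dom \<alpha> \<in> S" "inj_on \<alpha> (dom \<alpha>)"
  shows "(\<alpha>, Some |` dom \<alpha>) \<in> Rstar S pt_mult"
  using assms pt_mult_cancel_dom[of \<alpha>] by (simp add: Rstar_def mult_one_pt_mult_left)

lemma left_abundant_IC: "left_abundant (IC n) pt_mult"
proof (rule left_abundantI)
  fix \<alpha> assume "\<alpha> \<in> IC n"
  moreover from this have "Some |` ran \<alpha> \<in> IC n"
    by (intro partial_id_IC) (simp add: IC_def)
  ultimately show "\<exists>e. (\<alpha>, e) \<in> Lstar (IC n) pt_mult \<and> pt_mult e e = e"
    using Lstar_partial_id_ran partial_id_idem by blast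
qed

text \<open>Treats \<open>IC n\<close> and \<open>Q' n\<close> together: both are closed under
  passing from a map to the partial identity on its domain.\<close>

lemma right_abundant_subset_IC:
  assumes "S \<subseteq> IC n" "\<And>\<alpha>. \<alpha> \<in> S \<Longrightarrow> Some |` dom \<alpha> \<in> S"
  shows "right_abundant S pt_mult"
proof (rule right_abundantI)
  fix \<alpha> assume "\<alpha> \<in> S"
  moreover from this assms(1) have "inj_on \<alpha> (dom \<alpha>)"
    by (auto simp: IC_def)
  ultimately show "\<exists>e. (\<alpha>, e) \<in> Rstar S pt_mult \<and> pt_mult e e = e"
    using Rstar_partial_id_dom assms(2) partial_id_idem by blast
qed

theorem theorem2p8:
  fixes n :: nat
  assumes "n \<ge> 1"
  shows "abundant (IC n) pt_mult \<and> right_abundant (Q' n) pt_mult"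
proof -
  have dom: "Some |` dom \<alpha> \<in> IC n" if "\<alpha> \<in> IC n" for \<alpha>
    using that by (intro partial_id_IC) (simp add: IC_def)
  then have "right_abundant (IC n) pt_mult"
    by (intro right_abundant_subset_IC) auto
  moreover have "right_abundant (Q' n) pt_mult"
    using dom by (intro right_abundant_subset_IC[where n = n]) (auto simp: Q'_def)
  ultimately show ?thesis
    by (simp add: abundant_def left_abundant_IC)
qed

end
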